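(* Let $A\in\mathbb{R}^{m\times n}$ and $1\le k<\min\{m,n\}$. Let $V\in\mathbb{R}^{m\times k}$ and $W\in\mathbb{R}^{n\times k}$ be the matrices of leading $k$ left and right singular vectors of $A$. Let $p=(p_1,\dots,p_k)$ be distinct row indices in $\{1,\dots,m\}$ and $q=(q_1,\dots,q_k)$ distinct column indices in $\{1,\dots,n\}$, and set $C=A(:,q)\in\mathbb{R}^{m\times k}$, $R=A(p,:)\in\mathbb{R}^{k\times n}$, $P=I_m(:,p)$, $Q=I_n(:,q)$. Suppose that $C$ and $R$ have full rank $k$ and that the error constants $\eta_p=\|(P^TV)^{-1}\|$ and $\eta_q=\|(W^TQ)^{-1}\|$ are finite (i.e. $P^TV$ and $W^TQ$ are invertible). Set $U=C^I A R^I$. Then $$\|A-CUR\|\le(\eta_p+\eta_q)\,\sigma_{k+1}.$$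
   Context: $\|\cdot\|$ is the vector 2-norm and the matrix norm it induces (spectral norm). $\sigma_1\ge\sigma_2\ge\cdots$ are the singular values of $A$. $A(:,q)$ is the matrix formed by the columns of $A$ with indices $q_1,\dots,q_k$ (in that order), and $A(p,:)$ the matrix formed by the rows with indices $p_1,\dots,p_k$; $I_m(:,p)=[e_{p_1},\dots,e_{p_k}]\in\mathbb{R}^{m\times k}$ and $I_n(:,q)=[e_{q_1},\dots,e_{q_k}]\in\mathbb{R}^{n\times k}$ are the corresponding columns of identity matrices. "$V$ and $W$ are the matrices of leading $k$ left and right singular vectors" means that, for some singular value decomposition of $A$, the columns of $V$ and $W$ are the left and right singular vectors for $\sigma_1,\dots,\sigma_k$, so that $V^TV=W^TW=I$ and $V\,\mathrm{diag}(\sigma_1,\dots,\sigma_k)\,W^T$ is a best rank-$k$ approximation (truncated SVD) of $A$. For $C$ of full column rank, $C^I=(C^TC)^{-1}C^T$ is its left inverse; for $R$ of full row rank, $R^I=R^T(RR^T)^{-1}$ is its right inverse. *)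

theory Defs
  imports "HOL-Analysis.Analysis"
begin

definition spectral_norm :: "real^'n^'m \<Rightarrow> real" where
  "spectral_norm M = onorm (\<lambda>x. M *v x)"

text \<open>
  Full singular value decomposition in outer product form,
  \<open>A = \<sigma>\<^sub>1 v\<^sub>1 w\<^sub>1\<^sup>T + \<dots> + \<sigma>\<^sub>r v\<^sub>r w\<^sub>r\<^sup>T\<close> with \<open>r = min m n\<close>.
  Only \<open>v\<^sub>1, \<dots>, v\<^sub>m\<close>, \<open>w\<^sub>1, \<dots>, w\<^sub>n\<close> and \<open>\<sigma>\<^sub>1, \<dots>, \<sigma>\<^sub>r\<close> are meaningful.
\<close>
definition is_svd ::
  "real^'n^'m \<Rightarrow> (nat \<Rightarrow> real^'m) \<Rightarrow> (nat \<Rightarrow> real) \<Rightarrow> (nat \<Rightarrow> real^'n) \<Rightarrow> bool" where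
  "is_svd A v \<sigma> w \<longleftrightarrow>
     (\<forall>i\<in>{1..CARD('m)}. \<forall>j\<in>{1..CARD('m)}. v i \<bullet> v j = (if i = j then 1 else 0)) \<and>
     (\<forall>i\<in>{1..CARD('n)}. \<forall>j\<in>{1..CARD('n)}. w i \<bullet> w j = (if i = j then 1 else 0)) \<and>
     (\<forall>i\<in>{1..min CARD('m) CARD('n)}. 0 \<le> \<sigma> i) \<and>
     (\<forall>i\<in>{1..min CARD('m) CARD('n)}. \<forall>j\<in>{1..min CARD('m) CARD('n)}. i \<le> j \<longrightarrow> \<sigma> j \<le> \<sigma> i) \<and>
     A = (\<chi> a b. \<Sum>i = 1..min CARD('m) CARD('n). \<sigma> i * v i $ a * w i $ b)"

text \<open>
  The finite type \<open>'k\<close> carries no canonical order, so an enumeration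
  \<open>e\<close> of \<open>'k\<close> by \<open>1, \<dots>, CARD('k)\<close> says which vector forms which column.
\<close>
definition columns_from :: "('k \<Rightarrow> nat) \<Rightarrow> (nat \<Rightarrow> real^'m) \<Rightarrow> real^'k^'m" where
  "columns_from e v = (\<chi> i j. v (e j) $ i)"

definition select_columns :: "real^'n^'m \<Rightarrow> ('k \<Rightarrow> 'n) \<Rightarrow> real^'k^'m" where
  "select_columns M q = (\<chi> i j. M $ i $ q j)"

definition select_rows :: "real^'n^'m \<Rightarrow> ('k \<Rightarrow> 'm) \<Rightarrow> real^'n^'k" where
  "select_rows M p = (\<chi> i j. M $ p i $ j)"

definition left_inverse :: "real^'k^'m \<Rightarrow> real^'m^'k" where
  "left_inverse C = matrix_inv (transpose C ** C) ** transpose C"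

definition right_inverse :: "real^'n^'k \<Rightarrow> real^'k^'n" where
  "right_inverse R = transpose R ** matrix_inv (R ** transpose R)"

end

theory Submission
  imports Defs
begin

text \<open>
  Write \<open>\<Phi> = C C\<^sup>I\<close> and \<open>\<Phi>' = R\<^sup>I R\<close> for the orthogonal projections onto the column space of
  \<open>C\<close> and the row space of \<open>R\<close>. Then \<open>C U R = \<Phi> A \<Phi>'\<close>, and
  \<open>A - C U R = (I - \<Phi>) A + \<Phi> (A - A \<Phi>')\<close>. As \<open>\<Phi>\<close> does not increase norms, it suffices to show
  \<open>\<parallel>(I - \<Phi>) A\<parallel> \<le> \<eta>\<^sub>q \<sigma>\<^sub>k\<^sub>+\<^sub>1\<close> and \<open>\<parallel>A - A \<Phi>'\<parallel> \<le> \<eta>\<^sub>p \<sigma>\<^sub>k\<^sub>+\<^sub>1\<close>. The second bound is the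
  first one for the transpose of \<open>A\<close>, so only columns have to be treated
  (\<open>column_projection_error\<close>).

  For the columns, let \<open>S = Q (W\<^sup>T Q)\<^sup>-\<^sup>1 W\<^sup>T\<close>. This is an oblique projection with
  \<open>W\<^sup>T (I - S) = 0\<close>. Every vector \<open>A S x\<close> is a combination of the columns of \<open>C = A Q\<close>, so
  \<open>I - \<Phi>\<close> annihilates it, and \<open>(I - \<Phi>) A x = (I - \<Phi>) A (x - S x)\<close>. The vector \<open>x - S x\<close> is
  orthogonal to the leading \<open>k\<close> right singular vectors, so \<open>A\<close> stretches it by at most
  \<open>\<sigma>\<^sub>k\<^sub>+\<^sub>1\<close> (\<open>svd_tail_bound\<close>).

  What remains is \<open>\<parallel>I - S\<parallel> \<le> \<eta>\<^sub>q\<close>. The triangle inequality would only give \<open>1 + \<eta>\<^sub>q\<close>; the sharp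
  constant comes from the fact that complementary projections in an inner product space satisfy
  \<open>\<parallel>I - S\<parallel> \<le> \<parallel>S\<parallel>\<close> (\<open>complementary_projection_le_onorm\<close>), while \<open>\<parallel>S\<parallel> \<le> \<eta>\<^sub>q\<close> because \<open>Q\<close> and
  \<open>W\<close> have orthonormal columns.
\<close>

section \<open>Spectral norm and inverse matrices\<close>

lemma norm_mult_vec_le_spectral_norm:
  fixes M :: "real^'n^'m"
  shows "norm (M *v x) \<le> spectral_norm M * norm x"
  unfolding spectral_norm_def by (rule onorm) simp

lemma spectral_norm_nonneg: "0 \<le> spectral_norm (M :: real^'n^'m)"
  unfolding spectral_norm_def by (rule onorm_pos_le) simp

lemma spectral_norm_le:
  fixes M :: "real^'n^'m"
  assumes "\<And>x. norm (M *v x) \<le> b * norm x"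
  shows "spectral_norm M \<le> b"
  unfolding spectral_norm_def using assms by (rule onorm_le)

lemma inner_transpose_mult_vec:
  fixes M :: "real^'n^'m"
  shows "(transpose M *v x) \<bullet> y = x \<bullet> (M *v y)"
  by (simp add: dot_lmul_matrix)

text \<open>
  Put \<open>z = M\<^sup>T x\<close>. Then \<open>\<bar>z\<bar>\<^sup>2 = x \<bullet> M z \<le> \<bar>x\<bar> \<parallel>M\<parallel> \<bar>z\<bar>\<close>, and \<open>\<bar>z\<bar>\<close> cancels.
\<close>
lemma spectral_norm_transpose_le:
  fixes M :: "real^'n^'m"
  shows "spectral_norm (transpose M) \<le> spectral_norm M"
proof (rule spectral_norm_le)
  fix x
  define z where "z = transpose M *v x"
  have "norm z * norm z = x \<bullet> (M *v z)"
    using inner_transpose_mult_vec[of M x z]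
    by (simp only: power2_norm_eq_inner flip: power2_eq_square z_def)
  also have "\<dots> \<le> norm x * norm (M *v z)"
    by (rule norm_cauchy_schwarz)
  also have "\<dots> \<le> norm x * (spectral_norm M * norm z)"
    by (intro mult_left_mono norm_mult_vec_le_spectral_norm) simp
  finally have "norm z * norm z \<le> (spectral_norm M * norm x) * norm z"
    by (simp add: mult_ac)
  then have "norm z \<le> spectral_norm M * norm x"
    by (cases "z = 0") (auto simp: spectral_norm_nonneg)
  then show "norm (transpose M *v x) \<le> spectral_norm M * norm x"
    by (simp only: z_def)
qed

lemma spectral_norm_transpose:
  fixes M :: "real^'n^'m"
  shows "spectral_norm (transpose M) = spectral_norm M"
  using spectral_norm_transpose_le[of M] spectral_norm_transpose_le[of "transpose M"]
  by (simp add: transpose_transpose)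

lemma matrix_inv_mult:
  fixes M :: "real^'n^'n"
  assumes "invertible M"
  shows "matrix_inv M ** M = mat 1" and "M ** matrix_inv M = mat 1"
proof -
  have "M ** matrix_inv M = mat 1 \<and> matrix_inv M ** M = mat 1"
    using assms unfolding invertible_def matrix_inv_def by (rule someI_ex)
  then show "matrix_inv M ** M = mat 1" and "M ** matrix_inv M = mat 1"
    by auto
qed

lemma matrix_inv_transpose:
  fixes M :: "real^'n^'n"
  assumes "invertible M"
  shows "matrix_inv (transpose M) = transpose (matrix_inv M)"
proof -
  have "transpose (matrix_inv M) ** transpose M = mat 1"
    by (simp add: matrix_inv_mult[OF assms] flip: matrix_transpose_mul)
  moreover have "transpose M ** matrix_inv (transpose M) = mat 1"
    using assms by (simp add: matrix_inv_mult transpose_invertible)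
  ultimately show ?thesis
    by (metis matrix_mul_assoc matrix_mul_lid matrix_mul_rid)
qed

section \<open>Matrices with orthonormal columns and oblique projections\<close>

lemma norm_mult_vec_orthonormal_columns:
  fixes M :: "real^'k^'m"
  assumes "transpose M ** M = mat 1"
  shows "norm (M *v x) = norm x"
proof -
  have "(M *v x) \<bullet> (M *v x) = (transpose M *v (M *v x)) \<bullet> x"
    by (simp only: inner_transpose_mult_vec)
  also have "\<dots> = x \<bullet> x"
    by (simp only: matrix_vector_mul_assoc assms matrix_vector_mul_lid)
  finally show ?thesis
    by (simp add: norm_eq_sqrt_inner)
qed

lemma norm_transpose_mult_vec_orthonormal_columns:
  fixes M :: "real^'k^'m"
  assumes "transpose M ** M = mat 1"
  shows "norm (transpose M *v x) \<le> norm x"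
proof -
  have "spectral_norm M \<le> 1"
    by (rule spectral_norm_le) (simp add: norm_mult_vec_orthonormal_columns[OF assms])
  then have "spectral_norm (transpose M) * norm x \<le> 1 * norm x"
    unfolding spectral_norm_transpose by (intro mult_right_mono) auto
  then show ?thesis
    using norm_mult_vec_le_spectral_norm[of "transpose M" x] by linarith
qed

text \<open>
  Split \<open>x = u + z\<close> with \<open>z = f x\<close> and \<open>u\<close> in the kernel. Exchanging the lengths of \<open>u\<close> and \<open>z\<close>
  while keeping their directions does not change \<open>\<bar>u + z\<bar>\<close>, because the angle between them stays
  the same. The new vector has an image of length \<open>\<bar>u\<bar>\<close>, so \<open>\<bar>u\<bar> \<le> \<parallel>f\<parallel> \<bar>x\<bar>\<close>. If \<open>z = 0\<close> there
  is no direction to use; then the claim is \<open>1 \<le> \<parallel>f\<parallel>\<close>, which holds as \<open>f\<close> fixes its image.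
\<close>
lemma complementary_projection_le_onorm:
  fixes f :: "'a::real_inner \<Rightarrow> 'a"
  assumes f: "bounded_linear f" and idem: "\<And>x. f (f x) = f x" and nonzero: "f a \<noteq> 0"
  shows "norm (x - f x) \<le> onorm f * norm x"
proof -
  interpret f: bounded_linear f by (rule f)
  define z where "z = f x"
  define u where "u = x - f x"
  have fu: "f u = 0" and fz: "f z = z"
    by (simp_all add: u_def z_def f.diff idem)
  consider "u = 0" | "u \<noteq> 0" "z = 0" | "u \<noteq> 0" "z \<noteq> 0" by blast
  then have "norm u \<le> onorm f * norm x"
  proof cases
    case 1
    then show ?thesis by (simp add: onorm_pos_le[OF f])
  next
    case 2
    have "1 * norm (f a) \<le> onorm f * norm (f a)"
      using onorm[OF f, of "f a"] by (simp add: idem)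
    then have "1 \<le> onorm f"
      using nonzero by (simp del: mult_1_left)
    moreover have "u = x"
      using 2 by (simp add: u_def z_def)
    ultimately show ?thesis
      by (simp add: mult_le_cancel_right1)
  next
    case 3
    define y where "y = (norm z / norm u) *\<^sub>R u + (norm u / norm z) *\<^sub>R z"
    have "y \<bullet> y = (norm z / norm u)\<^sup>2 * (norm u)\<^sup>2 + 2 * (u \<bullet> z)
        + (norm u / norm z)\<^sup>2 * (norm z)\<^sup>2"
      using 3 unfolding y_def power2_norm_eq_inner
      by (simp add: inner_add_left inner_add_right inner_commute power2_eq_square)
    also have "\<dots> = (norm z)\<^sup>2 + 2 * (u \<bullet> z) + (norm u)\<^sup>2"
      using 3 by (simp add: power_divide)
    also have "\<dots> = (u + z) \<bullet> (u + z)"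
      by (simp add: power2_norm_eq_inner inner_add_left inner_add_right inner_commute)
    finally have "norm y = norm (u + z)"
      by (simp add: norm_eq_sqrt_inner)
    then have "norm y = norm x"
      by (simp add: u_def z_def)
    moreover have "norm (f y) = norm u"
      using 3 by (simp add: y_def f.add f.scaleR fu fz)
    ultimately show ?thesis
      using onorm[OF f, of y] by simp
  qed
  then show ?thesis
    by (simp only: u_def)
qed

section \<open>Singular value decompositions\<close>

lemma is_svd_transpose:
  assumes "is_svd A v \<sigma> w"
  shows "is_svd (transpose A) w \<sigma> v"
  using assms unfolding is_svd_def
  by (auto simp: min.commute transpose_def vec_eq_iff mult_ac)

text \<open>Bessel's inequality: the square of the distance from \<open>y\<close> to its projection is nonnegative.\<close>
lemma bessel_inequality:
  fixes u :: "'i \<Rightarrow> 'a::real_inner"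
  assumes I: "finite I" and on: "\<forall>i\<in>I. \<forall>j\<in>I. u i \<bullet> u j = (if i = j then 1 else 0)"
  shows "(\<Sum>i\<in>I. (u i \<bullet> y)\<^sup>2) \<le> (norm y)\<^sup>2"
proof -
  define z where "z = (\<Sum>i\<in>I. (u i \<bullet> y) *\<^sub>R u i)"
  have yz: "y \<bullet> z = (\<Sum>i\<in>I. (u i \<bullet> y)\<^sup>2)"
    by (simp add: z_def inner_sum_right power2_eq_square inner_commute)
  have "u i \<bullet> z = u i \<bullet> y" if "i \<in> I" for i
  proof -
    have "u i \<bullet> z = (\<Sum>j\<in>I. if j = i then u i \<bullet> y else 0)"
      unfolding z_def inner_sum_right using on that by (intro sum.cong) auto
    then show ?thesis
      using that I by simp
  qed
  then have "z \<bullet> z = (\<Sum>i\<in>I. (u i \<bullet> y)\<^sup>2)"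
    by (subst (1) z_def) (simp add: inner_sum_left power2_eq_square)
  moreover have "0 \<le> (y - z) \<bullet> (y - z)" by simp
  ultimately show ?thesis
    using yz by (simp add: inner_diff_left inner_diff_right inner_commute power2_norm_eq_inner)
qed

lemma svd_mult_vec:
  fixes A :: "real^'n^'m"
  assumes "is_svd A v \<sigma> w"
  shows "A *v y = (\<Sum>i = 1..min CARD('m) CARD('n). (\<sigma> i * (w i \<bullet> y)) *\<^sub>R v i)"
proof -
  let ?r = "min CARD('m) CARD('n)"
  have A: "A = (\<chi> a b. \<Sum>i = 1..?r. \<sigma> i * v i $ a * w i $ b)"
    using assms by (simp add: is_svd_def)
  have "(A *v y) $ a = (\<Sum>i = 1..?r. (\<sigma> i * (w i \<bullet> y)) *\<^sub>R v i) $ a" for a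
  proof -
    have "(A *v y) $ a = (\<Sum>b\<in>UNIV. \<Sum>i = 1..?r. \<sigma> i * v i $ a * w i $ b * y $ b)"
      by (subst A) (simp add: matrix_vector_mult_def sum_distrib_right)
    also have "\<dots> = (\<Sum>i = 1..?r. \<Sum>b\<in>UNIV. \<sigma> i * v i $ a * w i $ b * y $ b)"
      by (rule sum.swap)
    also have "\<dots> = (\<Sum>i = 1..?r. (\<sigma> i * (w i \<bullet> y)) *\<^sub>R v i) $ a"
      by (simp add: inner_vec_def sum_distrib_left sum_distrib_right mult_ac)
    finally show ?thesis .
  qed
  then show ?thesis
    by (simp add: vec_eq_iff)
qed

text \<open>
  In the singular vector bases \<open>A\<close> is diagonal, and on such a vector \<open>y\<close> only the entries
  \<open>\<sigma>\<^sub>k\<^sub>+\<^sub>1, \<sigma>\<^sub>k\<^sub>+\<^sub>2, \<dots>\<close> act.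
\<close>
lemma svd_tail_bound:
  fixes A :: "real^'n^'m"
  assumes svd: "is_svd A v \<sigma> w" and k: "k < min CARD('m) CARD('n)"
    and y: "\<forall>i\<in>{1..k}. w i \<bullet> y = 0"
  shows "norm (A *v y) \<le> \<sigma> (k + 1) * norm y"
proof (rule power2_le_imp_le)
  define r where "r = min CARD('m) CARD('n)"
  have r: "r \<le> CARD('m)" "r \<le> CARD('n)" "k + 1 \<in> {1..r}"
    using k by (auto simp: r_def)
  have v: "\<forall>i\<in>{1..r}. \<forall>j\<in>{1..r}. v i \<bullet> v j = (if i = j then 1 else 0)"
    and w: "\<forall>i\<in>{1..r}. \<forall>j\<in>{1..r}. w i \<bullet> w j = (if i = j then 1 else 0)"
    and pos: "\<forall>i\<in>{1..r}. 0 \<le> \<sigma> i"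
    and mono: "\<forall>i\<in>{1..r}. \<forall>j\<in>{1..r}. i \<le> j \<longrightarrow> \<sigma> j \<le> \<sigma> i"
    using svd r unfolding is_svd_def r_def by auto
  have v_norm: "norm (v i) = 1" if "i \<in> {1..r}" for i
    using v that by (simp add: norm_eq_sqrt_inner)
  have "(norm (A *v y))\<^sup>2 = (\<Sum>i = 1..r. (norm ((\<sigma> i * (w i \<bullet> y)) *\<^sub>R v i))\<^sup>2)"
    unfolding svd_mult_vec[OF svd] r_def[symmetric]
    by (rule norm_sum_Pythagorean) (use v in \<open>auto simp: pairwise_def orthogonal_def\<close>)
  also have "\<dots> = (\<Sum>i = 1..r. (\<sigma> i * (w i \<bullet> y))\<^sup>2)"
    by (intro sum.cong) (simp_all add: v_norm)
  also have "\<dots> \<le> (\<Sum>i = 1..r. (\<sigma> (k + 1))\<^sup>2 * (w i \<bullet> y)\<^sup>2)"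
  proof (rule sum_mono)
    fix i assume i: "i \<in> {1..r}"
    show "(\<sigma> i * (w i \<bullet> y))\<^sup>2 \<le> (\<sigma> (k + 1))\<^sup>2 * (w i \<bullet> y)\<^sup>2"
    proof (cases "i \<le> k")
      case True
      then show ?thesis using i y by simp
    next
      case False
      then have "\<sigma> i \<le> \<sigma> (k + 1)" "0 \<le> \<sigma> i"
        using i r(3) mono pos by auto
      then show ?thesis
        by (simp add: power_mult_distrib mult_right_mono power_mono)
    qed
  qed
  also have "\<dots> \<le> (\<sigma> (k + 1))\<^sup>2 * (norm y)\<^sup>2"
    unfolding sum_distrib_left[symmetric]
    by (intro mult_left_mono bessel_inequality w) simp_all
  finally show "(norm (A *v y))\<^sup>2 \<le> (\<sigma> (k + 1) * norm y)\<^sup>2"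
    by (simp add: power_mult_distrib)
  show "0 \<le> \<sigma> (k + 1) * norm y"
    using pos r(3) by simp
qed

lemma transpose_columns_from_mult_vec:
  "(transpose (columns_from e v) *v y) $ j = v (e j) \<bullet> y"
  by (simp add: columns_from_def transpose_def matrix_vector_mult_def inner_vec_def
      vector_matrix_mult_def mult.commute)

lemma orthonormal_columns_from:
  assumes "inj e" and "\<forall>i\<in>range e. \<forall>j\<in>range e. v i \<bullet> v j = (if i = j then 1 else 0)"
  shows "transpose (columns_from e v) ** columns_from e v = mat 1"
proof -
  have "(transpose (columns_from e v) ** columns_from e v) $ i $ j = mat 1 $ i $ j" for i j
  proof -
    have "(transpose (columns_from e v) ** columns_from e v) $ i $ j = v (e i) \<bullet> v (e j)"
      by (simp add: columns_from_def transpose_def matrix_matrix_mult_def inner_vec_def)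
    then show ?thesis
      using assms by (simp add: mat_def inj_eq)
  qed
  then show ?thesis
    by (simp add: vec_eq_iff)
qed

section \<open>Selected columns and the projection onto them\<close>

lemma mult_select_columns_mat: "A ** select_columns (mat 1) q = select_columns A q"
  by (simp add: select_columns_def matrix_matrix_mult_def mat_def vec_eq_iff if_distrib
      cong: if_cong)

lemma orthonormal_select_columns_mat:
  fixes q :: "'k::finite \<Rightarrow> 'n::finite"
  assumes "inj q"
  shows "transpose (select_columns (mat 1 :: real^'n^'n) q) ** select_columns (mat 1) q = mat 1"
  unfolding mult_select_columns_mat using assms
  by (auto simp: select_columns_def transpose_def mat_def vec_eq_iff inj_eq)

lemma transpose_select_rows: "transpose (select_rows A p) = select_columns (transpose A) p"
  by (simp add: select_columns_def select_rows_def transpose_def)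

text \<open>If \<open>C\<^sup>T C x = 0\<close>, then \<open>\<bar>C x\<bar>\<^sup>2 = x \<bullet> C\<^sup>T C x = 0\<close>, and \<open>C\<close> is injective.\<close>
lemma invertible_gram:
  fixes C :: "real^'k^'m"
  assumes "rank C = CARD('k)"
  shows "invertible (transpose C ** C)"
proof -
  have "x = 0" if "(transpose C ** C) *v x = 0" for x
  proof -
    have "(C *v x) \<bullet> (C *v x) = ((transpose C ** C) *v x) \<bullet> x"
      by (simp only: inner_transpose_mult_vec flip: matrix_vector_mul_assoc)
    then have "C *v x = 0" using that by simp
    then show ?thesis
      using assms matrix_nonfull_linear_equations_eq by blast
  qed
  then show ?thesis
    unfolding invertible_left_inverse matrix_left_invertible_ker by blast
qed

lemma left_inverse_mult:
  fixes C :: "real^'k^'m"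
  assumes "rank C = CARD('k)"
  shows "left_inverse C ** C = mat 1"
  using matrix_inv_mult(1)[OF invertible_gram[OF assms]]
  by (simp add: left_inverse_def matrix_mul_assoc[symmetric])

lemma transpose_column_projection:
  fixes C :: "real^'k^'m"
  assumes "rank C = CARD('k)"
  shows "transpose (C ** left_inverse C) = C ** left_inverse C"
proof -
  have "transpose (matrix_inv (transpose C ** C)) = matrix_inv (transpose C ** C)"
    by (simp add: matrix_transpose_mul transpose_transpose
        flip: matrix_inv_transpose[OF invertible_gram[OF assms]])
  then show ?thesis
    by (simp add: left_inverse_def matrix_transpose_mul transpose_transpose matrix_mul_assoc)
qed

text \<open>This turns the statement about rows of \<open>A\<close> into one about columns of \<open>A\<^sup>T\<close>.\<close>
lemma right_inverse_eq_transpose: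
  fixes R :: "real^'n^'k"
  assumes "rank R = CARD('k)"
  shows "right_inverse R = transpose (left_inverse (transpose R))"
proof -
  have "invertible (R ** transpose R)"
    using invertible_gram[of "transpose R"] assms by (simp add: rank_transpose transpose_transpose)
  from matrix_inv_transpose[OF this] show ?thesis
    by (simp add: right_inverse_def left_inverse_def matrix_transpose_mul transpose_transpose)
qed

text \<open>A symmetric projection splits \<open>x\<close> into orthogonal parts, so neither part exceeds \<open>x\<close>.\<close>
lemma orthogonal_projection_norm_le:
  fixes M :: "real^'m^'m"
  assumes sym: "transpose M = M" and idem: "M ** M = M"
  shows "norm (M *v x) \<le> norm x" and "norm (x - M *v x) \<le> norm x"
proof -
  have "(M *v x) \<bullet> x = (M *v x) \<bullet> (M *v x)"
    using inner_transpose_mult_vec[of M "M *v x" x]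
    by (simp only: sym matrix_vector_mul_assoc idem)
  then have "orthogonal (M *v x) (x - M *v x)"
    by (simp add: orthogonal_def inner_diff_right)
  from norm_add_Pythagorean[OF this]
  have "(norm (M *v x))\<^sup>2 + (norm (x - M *v x))\<^sup>2 = (norm x)\<^sup>2"
    by simp
  then have "(norm (M *v x))\<^sup>2 \<le> (norm x)\<^sup>2" "(norm (x - M *v x))\<^sup>2 \<le> (norm x)\<^sup>2"
    using zero_le_power2[of "norm (M *v x)"] zero_le_power2[of "norm (x - M *v x)"]
    by linarith+
  then show "norm (M *v x) \<le> norm x" and "norm (x - M *v x) \<le> norm x"
    by (auto intro: power2_le_imp_le)
qed

lemma column_projection_idem:
  fixes C :: "real^'k^'m"
  assumes "rank C = CARD('k)"
  shows "(C ** left_inverse C) ** (C ** left_inverse C) = C ** left_inverse C"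
  by (metis left_inverse_mult[OF assms] matrix_mul_assoc matrix_mul_rid)

section \<open>The one-sided error bound\<close>

text \<open>
  The oblique projection \<open>S = Q (W\<^sup>T Q)\<^sup>-\<^sup>1 W\<^sup>T\<close> fixes the columns of \<open>Q\<close>, hence it is not zero, and
  \<open>\<parallel>S\<parallel> \<le> \<parallel>(W\<^sup>T Q)\<^sup>-\<^sup>1\<parallel>\<close> since \<open>Q\<close> and \<open>W\<^sup>T\<close> do not increase norms.
\<close>
lemma oblique_projection_complement_bound:
  fixes W Q :: "real^'k^'n"
  assumes W: "transpose W ** W = mat 1" and Q: "transpose Q ** Q = mat 1"
    and inv: "invertible (transpose W ** Q)"
  defines "N \<equiv> matrix_inv (transpose W ** Q)"
  shows "norm (x - Q *v (N *v (transpose W *v x))) \<le> spectral_norm N * norm x"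
proof -
  define S where "S = Q ** N ** transpose W"
  have S: "S *v x = Q *v (N *v (transpose W *v x))" for x
    by (simp only: S_def flip: matrix_vector_mul_assoc)
  have "S ** Q = Q"
    by (simp add: S_def N_def matrix_inv_mult(1)[OF inv] flip: matrix_mul_assoc)
  then have SQ: "S *v (Q *v z) = Q *v z" for z
    by (simp add: matrix_vector_mul_assoc)
  have "norm (Q *v axis undefined 1) = norm (axis undefined 1 :: real^'k)"
    by (rule norm_mult_vec_orthonormal_columns[OF Q])
  then have "S *v (Q *v axis undefined 1) \<noteq> 0"
    unfolding SQ by auto
  moreover have "S *v (S *v x) = S *v x" for x
    unfolding S[of x] SQ ..
  ultimately have "norm (x - S *v x) \<le> onorm ((*v) S) * norm x"
    by (intro complementary_projection_le_onorm) auto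
  also have "\<dots> \<le> spectral_norm N * norm x"
  proof (intro mult_right_mono onorm_le)
    fix x
    have "norm (S *v x) = norm (N *v (transpose W *v x))"
      unfolding S by (rule norm_mult_vec_orthonormal_columns[OF Q])
    also have "\<dots> \<le> spectral_norm N * norm (transpose W *v x)"
      by (rule norm_mult_vec_le_spectral_norm)
    also have "\<dots> \<le> spectral_norm N * norm x"
      by (intro mult_left_mono norm_transpose_mult_vec_orthonormal_columns W spectral_norm_nonneg)
    finally show "norm (S *v x) \<le> spectral_norm N * norm x" .
  qed simp
  finally show ?thesis
    by (simp only: S)
qed

text \<open>
  With \<open>\<Phi> = C C\<^sup>I\<close>, the columns of \<open>A Q\<close> are invisible to \<open>I - \<Phi>\<close>, so \<open>x\<close> may be replaced by
  \<open>y = x - Q (W\<^sup>T Q)\<^sup>-\<^sup>1 W\<^sup>T x\<close>, which satisfies \<open>W\<^sup>T y = 0\<close>.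
\<close>
lemma column_projection_error:
  fixes A :: "real^'n^'m" and W Q :: "real^'k^'n" and C :: "real^'k^'m"
  assumes W: "transpose W ** W = mat 1" and Q: "transpose Q ** Q = mat 1"
    and inv: "invertible (transpose W ** Q)"
    and C: "C = A ** Q" and rank: "rank C = CARD('k)"
    and s: "0 \<le> s" and tail: "\<And>y. transpose W *v y = 0 \<Longrightarrow> norm (A *v y) \<le> s * norm y"
  shows "spectral_norm (A - C ** left_inverse C ** A)
    \<le> spectral_norm (matrix_inv (transpose W ** Q)) * s"
proof (rule spectral_norm_le)
  fix x
  define N where "N = matrix_inv (transpose W ** Q)"
  define \<Phi> where "\<Phi> = C ** left_inverse C"
  define z where "z = N *v (transpose W *v x)"
  define y where "y = x - Q *v z"
  have Wy: "transpose W *v y = 0"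
  proof -
    have "transpose W *v (Q *v z) = ((transpose W ** Q) ** N) *v (transpose W *v x)"
      by (simp only: z_def matrix_vector_mul_assoc matrix_mul_assoc)
    also have "\<dots> = transpose W *v x"
      by (simp only: N_def matrix_inv_mult(2)[OF inv] matrix_vector_mul_lid)
    finally show ?thesis
      by (simp only: y_def matrix_vector_mult_diff_distrib) simp
  qed
  have "\<Phi> ** C = C"
    by (simp add: \<Phi>_def left_inverse_mult[OF rank] flip: matrix_mul_assoc)
  then have PC: "\<Phi> *v (C *v z) = C *v z"
    by (simp add: matrix_vector_mul_assoc)
  have Ay: "A *v y = A *v x - C *v z"
    by (simp add: y_def C matrix_vector_mult_diff_distrib matrix_vector_mul_assoc)
  have "(A - C ** left_inverse C ** A) *v x = A *v x - \<Phi> *v (A *v x)"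
    by (simp add: \<Phi>_def matrix_vector_mult_diff_rdistrib matrix_vector_mul_assoc)
  also have "\<dots> = A *v y - \<Phi> *v (A *v y)"
    by (simp add: Ay matrix_vector_mult_diff_distrib PC)
  finally have "norm ((A - C ** left_inverse C ** A) *v x) \<le> norm (A *v y)"
    using orthogonal_projection_norm_le(2)[OF transpose_column_projection[OF rank]
        column_projection_idem[OF rank]]
    by (simp add: \<Phi>_def)
  also have "\<dots> \<le> s * norm y"
    by (rule tail[OF Wy])
  also have "\<dots> \<le> s * (spectral_norm N * norm x)"
    using oblique_projection_complement_bound[OF W Q inv, of x] s
    by (intro mult_left_mono) (simp_all only: y_def z_def N_def)
  finally show "norm ((A - C ** left_inverse C ** A) *v x)
      \<le> spectral_norm (matrix_inv (transpose W ** Q)) * s * norm x"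
    by (simp add: N_def mult_ac)
qed

lemma svd_selected_columns_error:
  fixes A :: "real^'n^'m" and e :: "'k::finite \<Rightarrow> nat" and q :: "'k \<Rightarrow> 'n"
  assumes k: "CARD('k) < min CARD('m) CARD('n)" and svd: "is_svd A v \<sigma> w"
    and e: "bij_betw e UNIV {1..CARD('k)}" and q: "inj q"
    and rank: "rank (select_columns A q) = CARD('k)"
    and inv: "invertible (transpose (columns_from e w) ** select_columns (mat 1) q)"
  shows "spectral_norm (A - select_columns A q ** left_inverse (select_columns A q) ** A)
    \<le> spectral_norm (matrix_inv (transpose (columns_from e w) ** select_columns (mat 1) q))
      * \<sigma> (CARD('k) + 1)"
proof (rule column_projection_error[OF _ orthonormal_select_columns_mat[OF q] inv _ rank])
  have e': "inj e" "range e = {1..CARD('k)}"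
    using e by (auto simp: bij_betw_def)
  have w: "\<forall>i\<in>{1..CARD('n)}. \<forall>j\<in>{1..CARD('n)}. w i \<bullet> w j = (if i = j then 1 else 0)"
    using svd by (simp add: is_svd_def)
  show "transpose (columns_from e w) ** columns_from e w = mat 1"
    using w k by (intro orthonormal_columns_from e'(1)) (auto simp: e'(2))
  show "select_columns A q = A ** select_columns (mat 1) q"
    by (simp only: mult_select_columns_mat)
  show "0 \<le> \<sigma> (CARD('k) + 1)"
    using svd k by (simp add: is_svd_def)
  fix y assume "transpose (columns_from e w) *v y = 0"
  then have "w (e j) \<bullet> y = 0" for j
    by (metis transpose_columns_from_mult_vec zero_index)
  then have "\<forall>i\<in>{1..CARD('k)}. w i \<bullet> y = 0"
    unfolding e'(2)[symmetric] by blast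
  then show "norm (A *v y) \<le> \<sigma> (CARD('k) + 1) * norm y"
    by (rule svd_tail_bound[OF svd k])
qed

section \<open>The error of the CUR factorization\<close>

theorem theorem4p1:
  fixes A :: "real^'n^'m"
    and v :: "nat \<Rightarrow> real^'m" and \<sigma> :: "nat \<Rightarrow> real" and w :: "nat \<Rightarrow> real^'n"
    and e :: "'k::finite \<Rightarrow> nat"
    and V :: "real^'k^'m" and W :: "real^'k^'n"
    and p :: "'k \<Rightarrow> 'm" and q :: "'k \<Rightarrow> 'n"
    and C :: "real^'k^'m" and U :: "real^'k^'k" and R :: "real^'n^'k"
    and P :: "real^'k^'m" and Q :: "real^'k^'n"
    and \<eta>\<^sub>p \<eta>\<^sub>q :: real
  assumes "CARD('k) < min CARD('m) CARD('n)"
    and "is_svd A v \<sigma> w"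
    and "bij_betw e UNIV {1..CARD('k)}"
    and "V = columns_from e v"
    and "W = columns_from e w"
    and "inj p" and "inj q"
    and "C = select_columns A q"
    and "R = select_rows A p"
    and "P = select_columns (mat 1) p"
    and "Q = select_columns (mat 1) q"
    and "rank C = CARD('k)" and "rank R = CARD('k)"
    and "invertible (transpose P ** V)" and "invertible (transpose W ** Q)"
    and "\<eta>\<^sub>p = spectral_norm (matrix_inv (transpose P ** V))"
    and "\<eta>\<^sub>q = spectral_norm (matrix_inv (transpose W ** Q))"
    and "U = left_inverse C ** A ** right_inverse R"
  shows "spectral_norm (A - C ** U ** R) \<le> (\<eta>\<^sub>p + \<eta>\<^sub>q) * \<sigma> (CARD('k) + 1)"
proof -
  let ?s = "\<sigma> (CARD('k) + 1)"
  let ?D = "transpose R"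
  define \<Phi> where "\<Phi> = C ** left_inverse C"
  have columns: "spectral_norm (A - \<Phi> ** A) \<le> \<eta>\<^sub>q * ?s"
    using svd_selected_columns_error[of A v \<sigma> w e q] assms by (simp add: \<Phi>_def)
  have D: "?D = select_columns (transpose A) p"
    using assms by (simp add: transpose_select_rows)
  have PV: "transpose V ** P = transpose (transpose P ** V)"
    by (simp add: matrix_transpose_mul transpose_transpose)
  have "spectral_norm (transpose A - ?D ** left_inverse ?D ** transpose A)
      \<le> spectral_norm (matrix_inv (transpose V ** P)) * ?s"
    unfolding D \<open>V = columns_from e v\<close> \<open>P = select_columns (mat 1) p\<close>
  proof (rule svd_selected_columns_error)
    show "rank (select_columns (transpose A) p) = CARD('k)"
      using \<open>rank R = CARD('k)\<close> by (simp add: rank_transpose flip: D)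
    show "invertible (transpose (columns_from e v) ** select_columns (mat 1) p)"
      using PV assms(4,10,14) by (metis transpose_invertible)
      show "is_svd (transpose A) w \<sigma> v"
      using \<open>is_svd A v \<sigma> w\<close> by (rule is_svd_transpose)
  qed (use assms in \<open>simp_all add: min.commute\<close>)
  also have "spectral_norm (matrix_inv (transpose V ** P)) = \<eta>\<^sub>p"
    unfolding PV using assms by (simp add: matrix_inv_transpose spectral_norm_transpose)
  also have "transpose A - ?D ** left_inverse ?D ** transpose A
      = transpose (A - A ** (right_inverse R ** R))"
  proof -
    have "transpose (right_inverse R ** R) = ?D ** left_inverse ?D"
      using \<open>rank R = CARD('k)\<close>
      by (simp add: right_inverse_eq_transpose matrix_transpose_mul transpose_transpose)
    then have "transpose (A ** (right_inverse R ** R)) = ?D ** left_inverse ?D ** transpose A"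
      by (simp add: matrix_transpose_mul)
    then show ?thesis
      by (simp add: transpose_def vec_eq_iff)
  qed
  finally have rows: "spectral_norm (A - A ** (right_inverse R ** R)) \<le> \<eta>\<^sub>p * ?s"
    by (simp only: spectral_norm_transpose)
  show ?thesis
  proof (rule spectral_norm_le)
    fix x
    have "C ** U ** R = \<Phi> ** (A ** (right_inverse R ** R))"
      using assms by (simp add: \<Phi>_def matrix_mul_assoc)
    then have "(A - C ** U ** R) *v x
        = (A - \<Phi> ** A) *v x + \<Phi> *v ((A - A ** (right_inverse R ** R)) *v x)"
      by (simp add: matrix_vector_mult_diff_rdistrib matrix_vector_mult_diff_distrib
          matrix_vector_mul_assoc matrix_mul_assoc)
    then have "norm ((A - C ** U ** R) *v x)
        \<le> norm ((A - \<Phi> ** A) *v x) + norm (\<Phi> *v ((A - A ** (right_inverse R ** R)) *v x))"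
      by (simp only: norm_triangle_ineq)
    also have "\<dots> \<le> norm ((A - \<Phi> ** A) *v x) + norm ((A - A ** (right_inverse R ** R)) *v x)"
      using orthogonal_projection_norm_le(1)[OF transpose_column_projection column_projection_idem]
        \<open>rank C = CARD('k)\<close> by (simp add: \<Phi>_def)
    also have "\<dots> \<le> \<eta>\<^sub>q * ?s * norm x + \<eta>\<^sub>p * ?s * norm x"
      by (intro add_mono order_trans[OF norm_mult_vec_le_spectral_norm] mult_right_mono
          columns rows) simp_all
    finally show "norm ((A - C ** U ** R) *v x) \<le> (\<eta>\<^sub>p + \<eta>\<^sub>q) * ?s * norm x"
      by (simp add: algebra_simps)
  qed
qed

end
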